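(* Let $\tau\in\mathbb{C}$ with $\operatorname{Im}\tau>0$ and let $n$ be a positive integer. Then for all $z\in\mathbb{C}$, $$\sum_{k=0}^{2n-1}(-1)^k\theta_3^{2n}\left(z+\frac{k\pi}{2n}\,\Big|\,\tau\right)=H_{1,2n}(\tau)\,\theta_2(2nz\,|\,2n\tau),$$ where $$H_{1,2n}(\tau)=2n\,q^{-\frac{n}{4}}\sum_{\substack{s_1,\dots,s_{2n}=-\infty\\ s_1+\cdots+s_{2n}=n}}^{\infty}q^{\frac12(s_1^2+s_2^2+\cdots+s_{2n}^2)},$$ the sum being over all integers $s_1,\dots,s_{2n}$ with the indicated sum.
   Context: For $\operatorname{Im}\tau>0$ put $q=e^{2\pi i\tau}$, and for real $a$ let $q^a:=e^{2\pi i a\tau}$. The Jacobi theta functions used are, for $z\in\mathbb{C}$, $$\theta_2(z|\tau)=q^{\frac18}\sum_{n=-\infty}^{\infty}q^{\frac{n(n+1)}{2}}e^{(2n+1)iz},\qquad \theta_3(z|\tau)=\sum_{n=-\infty}^{\infty}q^{\frac{n^2}{2}}e^{2niz}.$$ When the second argument is $c\tau$ for a constant $c>0$, $q$ is replaced by $e^{2\pi i c\tau}$ in these definitions. The notation $\theta_3^{2n}(w|\tau)$ means $(\theta_3(w|\tau))^{2n}$. *)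

theory Defs
  imports "HOL-Analysis.Analysis"
begin

text \<open>
  \<open>qpow \<tau> a\<close> is \<open>q\<^sup>a\<close> with \<open>q = exp (2 \<pi> \<i> \<tau>)\<close>.  It depends on \<open>\<tau>\<close> itself, not only on
  the number \<open>q\<close>, so fractional powers involve no choice of a branch.
\<close>
definition qpow :: "complex \<Rightarrow> real \<Rightarrow> complex" where
  "qpow \<tau> a = exp (2 * of_real pi * \<i> * of_real a * \<tau>)"

text \<open>
  For \<open>Im \<tau> > 0\<close> all series below converge absolutely, so the bilateral sums can be taken as
  unordered sums over the integers.
\<close>
definition theta2 :: "complex \<Rightarrow> complex \<Rightarrow> complex" where
  "theta2 z \<tau> = qpow \<tau> (1 / 8) *
     (\<Sum>\<^sub>\<infinity>n\<in>(UNIV :: int set).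
        qpow \<tau> (of_int (n * (n + 1)) / 2) * exp (of_int (2 * n + 1) * \<i> * z))"

definition theta3 :: "complex \<Rightarrow> complex \<Rightarrow> complex" where
  "theta3 z \<tau> =
     (\<Sum>\<^sub>\<infinity>n\<in>(UNIV :: int set).
        qpow \<tau> (of_int (n ^ 2) / 2) * exp (2 * of_int n * \<i> * z))"

text \<open>
  The integer tuples \<open>(s\<^sub>1, \<dots>, s\<^sub>m)\<close> with sum \<open>t\<close>; extensional functions, so that each tuple is
  represented exactly once.
\<close>
definition int_tuples_with_sum :: "nat \<Rightarrow> int \<Rightarrow> (nat \<Rightarrow> int) set" where
  "int_tuples_with_sum m t = {s \<in> {1..m} \<rightarrow>\<^sub>E UNIV. (\<Sum>i=1..m. s i) = t}"

text \<open>\<open>H1 n \<tau>\<close> is \<open>H\<^sub>1\<^sub>,\<^sub>2\<^sub>n(\<tau>)\<close>: the subscript is twice the argument \<open>n\<close>.\<close>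
definition H1 :: "nat \<Rightarrow> complex \<Rightarrow> complex" where
  "H1 n \<tau> = 2 * of_nat n * qpow \<tau> (- of_nat n / 4) *
     (\<Sum>\<^sub>\<infinity>s\<in>int_tuples_with_sum (2 * n) (int n).
        qpow \<tau> (of_int (\<Sum>i=1..2*n. (s i) ^ 2) / 2))"

end

theory Submission
  imports Defs
begin

text \<open>
  Expanding the power of \<open>theta3\<close> as a product of \<open>2n\<close> series gives a sum over all integer tuples
  \<open>s = (s\<^sub>1, \<dots>, s\<^sub>2\<^sub>n)\<close> of \<open>q\<close> to the power \<open>(s\<^sub>1\<^sup>2 + \<dots> + s\<^sub>2\<^sub>n\<^sup>2) / 2\<close> times \<open>exp (2 S \<i> z)\<close>, where
  \<open>S = s\<^sub>1 + \<dots> + s\<^sub>2\<^sub>n\<close> (\<open>theta3_power_eq_infsum\<close>).  Translating \<open>z\<close> by \<open>k \<pi> / (2n)\<close> multiplies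
  such a term by a root of unity depending only on \<open>S\<close>, and the alternating sum over \<open>k\<close> is a
  discrete Fourier projection: it keeps, with weight \<open>2n\<close>, exactly the tuples with
  \<open>S \<equiv> n (mod 2n)\<close> (\<open>alternating_root_of_unity_sum\<close>).

  Such a tuple has \<open>S = n + 2nr\<close> for a unique integer \<open>r\<close>; subtracting \<open>r\<close> from every entry leaves a
  tuple with sum \<open>n\<close> (\<open>bij_betw_shift_tuple\<close>).  Completing the square shows that the term
  factors into a part depending on the reduced tuple only and a part depending on \<open>r\<close> only
  (\<open>tuple_term_shift\<close>).  The first part sums to the series in \<open>H1\<close>, the second to \<open>theta2\<close>
  at \<open>2nz\<close> and \<open>2n\<tau>\<close>.  Everything converges absolutely, since the quadratic exponent dominates the
  linear one.
\<close>

section \<open>Absolute convergence\<close>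

lemma summable_exp_neg_abs_int:
  "(\<lambda>n::int. exp (- real_of_int \<bar>n\<bar>)) summable_on UNIV"
proof -
  have nat: "(\<lambda>n::nat. exp (- real n)) summable_on UNIV"
  proof (rule summable_nonneg_imp_summable_on)
    have "exp (- real n) = exp (-1) ^ n" for n
      by (simp add: exp_of_nat_mult [symmetric])
    moreover have "summable (\<lambda>n. exp (-1 :: real) ^ n)"
      by (rule summable_geometric) simp
    ultimately show "summable (\<lambda>n::nat. exp (- real n))"
      by (simp only:)
  qed simp
  have pos: "(\<lambda>n::int. exp (- real_of_int \<bar>n\<bar>)) summable_on range int"
    by (subst summable_on_reindex) (use nat in \<open>auto simp: o_def\<close>)
  have neg: "(\<lambda>n::int. exp (- real_of_int \<bar>n\<bar>)) summable_on range (\<lambda>n. - int n)"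
    by (subst summable_on_reindex) (use nat in \<open>auto simp: o_def inj_on_def\<close>)
  have "k \<in> range int \<union> range (\<lambda>n. - int n)" for k
    by (cases k rule: int_cases2) auto
  then have "range int \<union> range (\<lambda>n. - int n) = UNIV" by blast
  then show ?thesis
    using summable_on_union [OF pos neg] by (simp only:)
qed

definition theta3_term :: "complex \<Rightarrow> complex \<Rightarrow> int \<Rightarrow> complex" where
  "theta3_term \<tau> z n = qpow \<tau> (of_int (n ^ 2) / 2) * exp (2 * of_int n * \<i> * z)"

lemma norm_theta3_term:
  "norm (theta3_term \<tau> z n) = exp (- (pi * Im \<tau>) * (of_int n)\<^sup>2 - 2 * Im z * of_int n)"
  unfolding theta3_term_def qpow_def exp_add [symmetric] norm_exp_eq_Re
  by (simp add: algebra_simps)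

text \<open>
  With \<open>a = \<pi> Im \<tau> > 0\<close> and \<open>b = 2 \<bar>Im z\<bar> + 1\<close>, the maximum \<open>b\<^sup>2 / (4a)\<close> of \<open>b x - a x\<^sup>2\<close> gives a
  domination by a constant multiple of \<open>exp (- \<bar>n\<bar>)\<close>.
\<close>
lemma theta3_term_abs_summable:
  assumes "Im \<tau> > 0"
  shows "(\<lambda>n. norm (theta3_term \<tau> z n)) summable_on UNIV"
proof (rule Infinite_Sum.abs_summable_on_comparison_test')
  define a where "a = pi * Im \<tau>"
  define b where "b = 2 * \<bar>Im z\<bar> + 1"
  have a: "a > 0" using assms by (simp add: a_def)
  show "(\<lambda>n::int. exp (b\<^sup>2 / (4 * a)) * exp (- real_of_int \<bar>n\<bar>)) summable_on UNIV"
    by (intro summable_on_cmult_right summable_exp_neg_abs_int)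
  fix n :: int
  define x where "x = \<bar>real_of_int n\<bar>"
  have "0 \<le> (2 * a * x - b)\<^sup>2 / (4 * a)" using a by simp
  also have "\<dots> = a * x\<^sup>2 - b * x + b\<^sup>2 / (4 * a)"
    using a by (simp add: field_simps power2_eq_square)
  finally have 1: "- a * x\<^sup>2 + b * x \<le> b\<^sup>2 / (4 * a)" by simp
  have "- (2 * Im z * of_int n) \<le> \<bar>2 * Im z * of_int n\<bar>" by linarith
  also have "\<dots> = b * x - x" by (simp add: b_def x_def abs_mult algebra_simps)
  finally have "- a * (of_int n)\<^sup>2 - 2 * Im z * of_int n \<le> b\<^sup>2 / (4 * a) - x"
    using 1 by (simp add: x_def)
  then show "norm (theta3_term \<tau> z n) \<le> exp (b\<^sup>2 / (4 * a)) * exp (- real_of_int \<bar>n\<bar>)"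
    by (simp add: norm_theta3_term a_def x_def flip: exp_add)
qed

text \<open>
  Unless one of the factors vanishes identically, the product formula for the norms evaluates the
  sum of the norms of the products to something nonzero, which an unsummable family, whose
  \<open>infsum\<close> is \<open>0\<close>, cannot have.
\<close>
lemma abs_summable_on_prod_PiE:
  fixes f :: "'a \<Rightarrow> 'b \<Rightarrow> 'c :: {banach, real_normed_field}"
  assumes "finite A" and summable: "\<And>x. x \<in> A \<Longrightarrow> (\<lambda>y. norm (f x y)) summable_on B x"
  shows "(\<lambda>g. norm (\<Prod>x\<in>A. f x (g x))) summable_on PiE A B"
proof (cases "\<exists>x\<in>A. infsum (\<lambda>y. norm (f x y)) (B x) = 0")
  case True
  then obtain x where x: "x \<in> A" "infsum (\<lambda>y. norm (f x y)) (B x) = 0" by blast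
  have "f x y = 0" if "y \<in> B x" for y
    using nonneg_infsum_le_0D [of "\<lambda>y. norm (f x y)" "B x" y] x summable that by simp
  then have "(\<Prod>x\<in>A. f x (g x)) = 0" if "g \<in> PiE A B" for g
    using that x \<open>finite A\<close> by (auto intro!: prod_zero bexI [of _ x])
  then show ?thesis
    by (subst summable_on_cong [where g = "\<lambda>_. 0"]) auto
next
  case False
  have "infsum (\<lambda>g. \<Prod>x\<in>A. norm (f x (g x))) (PiE A B) =
      (\<Prod>x\<in>A. infsum (\<lambda>y. norm (f x y)) (B x))"
    by (rule infsum_prod_PiE_abs) (use assms in auto)
  also have "\<dots> \<noteq> 0" using False \<open>finite A\<close> by simp
  finally have "(\<lambda>g. \<Prod>x\<in>A. norm (f x (g x))) summable_on PiE A B"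
    using infsum_not_exists by blast
  then show ?thesis by (simp add: prod_norm)
qed

lemma infsum_finite_sum_swap:
  fixes f :: "'a \<Rightarrow> 'b \<Rightarrow> 'c :: {topological_comm_monoid_add, t2_space}"
  assumes "finite K" and "\<And>k. k \<in> K \<Longrightarrow> f k summable_on A"
  shows "(\<Sum>k\<in>K. infsum (f k) A) = (\<Sum>\<^sub>\<infinity>x\<in>A. \<Sum>k\<in>K. f k x)"
proof -
  have "((\<lambda>x. \<Sum>k\<in>K. f k x) has_sum (\<Sum>k\<in>K. infsum (f k) A)) A"
    using assms
  proof (induction K rule: finite_induct)
    case empty
    show ?case by simp
  next
    case (insert k K)
    have "((\<lambda>x. f k x + (\<Sum>k\<in>K. f k x)) has_sum
        (infsum (f k) A + (\<Sum>k\<in>K. infsum (f k) A))) A"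
      by (intro has_sum_add has_sum_infsum insert.IH) (simp_all add: insert.prems)
    then show ?case
      using insert.hyps by simp
  qed
  then show ?thesis by (rule infsumI [symmetric])
qed

section \<open>Powers of the theta function as sums over tuples\<close>

definition tuple_term :: "complex \<Rightarrow> complex \<Rightarrow> nat \<Rightarrow> (nat \<Rightarrow> int) \<Rightarrow> complex" where
  "tuple_term \<tau> z m s =
     qpow \<tau> (of_int (\<Sum>i=1..m. (s i) ^ 2) / 2) * exp (2 * of_int (\<Sum>i=1..m. s i) * \<i> * z)"

lemma qpow_add: "qpow \<tau> (a + b) = qpow \<tau> a * qpow \<tau> b"
  by (simp add: qpow_def algebra_simps flip: exp_add)

lemma qpow_scale: "qpow (of_nat m * \<tau>) a = qpow \<tau> (of_nat m * a)"
  by (simp add: qpow_def mult_ac)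

lemma prod_theta3_term: "(\<Prod>i=1..m. theta3_term \<tau> z (s i)) = tuple_term \<tau> z m s"
  by (simp add: theta3_term_def tuple_term_def qpow_def prod.distrib sum_distrib_left
      sum_distrib_right sum_divide_distrib flip: exp_sum)

lemma tuple_term_summable:
  assumes "Im \<tau> > 0"
  shows "tuple_term \<tau> z m summable_on ({1..m} \<rightarrow>\<^sub>E UNIV)"
proof -
  have "(\<lambda>s. norm (\<Prod>i\<in>{1..m}. theta3_term \<tau> z (s i))) summable_on ({1..m} \<rightarrow>\<^sub>E UNIV)"
    by (rule abs_summable_on_prod_PiE [where f = "\<lambda>_. theta3_term \<tau> z"])
      (simp_all add: theta3_term_abs_summable [OF assms])
  then show ?thesis
    unfolding prod_theta3_term by (rule abs_summable_summable)
qed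

lemma theta3_power_eq_infsum:
  assumes "Im \<tau> > 0"
  shows "theta3 z \<tau> ^ m = (\<Sum>\<^sub>\<infinity>s\<in>{1..m} \<rightarrow>\<^sub>E UNIV. tuple_term \<tau> z m s)"
proof -
  have "(\<Sum>\<^sub>\<infinity>s\<in>{1..m} \<rightarrow>\<^sub>E UNIV. \<Prod>i\<in>{1..m}. theta3_term \<tau> z (s i)) =
      (\<Prod>i\<in>{1..m}. \<Sum>\<^sub>\<infinity>n. theta3_term \<tau> z n)"
    by (rule infsum_prod_PiE_abs [where f = "\<lambda>_. theta3_term \<tau> z"])
      (simp_all add: theta3_term_abs_summable [OF assms])
  also have "\<dots> = theta3 z \<tau> ^ m"
    by (simp add: theta3_def theta3_term_def)
  finally show ?thesis
    by (simp only: prod_theta3_term)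
qed

section \<open>Projection onto a residue class of the tuple sum\<close>

text \<open>
  The summands are the powers of \<open>exp (\<i> \<pi> (S - n) / n)\<close>, which is a \<open>2n\<close>-th root of unity and
  equals \<open>1\<close> exactly in the first case; in the second the geometric sum vanishes.
\<close>
lemma alternating_root_of_unity_sum:
  fixes S :: int
  assumes "n \<ge> 1"
  shows "(\<Sum>k=0..2*n-1. (-1) ^ k * exp (2 * of_int S * \<i> * (of_nat k * of_real pi / (2 * of_nat n))))
      = (if 2 * int n dvd S - int n then 2 * of_nat n else (0 :: complex))"
proof -
  define w :: complex where "w = exp (of_real pi * \<i> * of_int (S - int n) / of_nat n)"
  have n: "(of_nat n :: complex) \<noteq> 0" "real n \<noteq> 0" using assms by auto
  have w: "w = - exp (of_real pi * \<i> * of_int S / of_nat n)"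
  proof -
    have "w = exp (of_real pi * \<i> * of_int S / of_nat n - of_real pi * \<i>)"
      unfolding w_def using n by (simp add: diff_divide_distrib right_diff_distrib)
    then show ?thesis by (simp add: exp_diff)
  qed
  have "(-1) ^ k * exp (2 * of_int S * \<i> * (of_nat k * of_real pi / (2 * of_nat n))) = w ^ k" for k
    unfolding w power_minus [of "exp _"] using n
    by (simp add: field_simps flip: exp_of_nat_mult)
  moreover have "{0..2*n-1} = {..<2*n}" using assms by auto
  ultimately have sum: "(\<Sum>k=0..2*n-1. (-1) ^ k *
      exp (2 * of_int S * \<i> * (of_nat k * of_real pi / (2 * of_nat n)))) = (\<Sum>k<2*n. w ^ k)"
    by simp
  have "w ^ (2 * n) = exp (2 * of_real pi * \<i> * of_int (S - int n))"
    unfolding w_def exp_of_nat_mult [symmetric] using n by (simp add: mult_ac)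
  then have root: "w ^ (2 * n) = 1"
    using exp_integer_2pi [OF Ints_of_int, of "S - int n"]
    by (simp only: of_real_mult of_real_of_int_eq of_real_numeral mult_ac)
  have cancel_pi: "pi * x / real n = y * pi \<longleftrightarrow> x = real n * y" for x y
  proof -
    have "pi * x / real n = y * pi \<longleftrightarrow> pi * x = pi * (real n * y)"
      using n by (simp only: divide_eq_eq mult_ac) simp
    then show ?thesis by (simp only: mult_cancel_left pi_neq_zero simp_thms)
  qed
  have "w = 1 \<longleftrightarrow> (\<exists>r::int. pi * of_int (S - int n) / of_nat n = of_int (2 * r) * pi)"
    unfolding w_def exp_eq_1 by (simp add: Im_divide_of_nat Re_divide_of_nat)
  also have "\<dots> \<longleftrightarrow> (\<exists>r::int. real_of_int (S - int n) = of_int (2 * int n * r))"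
    unfolding cancel_pi by (simp add: mult_ac)
  also have "\<dots> \<longleftrightarrow> 2 * int n dvd S - int n"
    unfolding of_int_eq_iff dvd_def ..
  finally have "w = 1 \<longleftrightarrow> 2 * int n dvd S - int n" .
  then show ?thesis
    unfolding sum using root by (auto simp: geometric_sum)
qed

lemma tuple_term_translate:
  "tuple_term \<tau> (z + d) m s = tuple_term \<tau> z m s * exp (2 * of_int (\<Sum>i=1..m. s i) * \<i> * d)"
  by (simp add: tuple_term_def distrib_left exp_add)

definition tuples_in_class :: "nat \<Rightarrow> (nat \<Rightarrow> int) set" where
  "tuples_in_class n = {s \<in> {1..2*n} \<rightarrow>\<^sub>E UNIV. 2 * int n dvd (\<Sum>i=1..2*n. s i) - int n}"

lemma alternating_theta3_sum:
  assumes "Im \<tau> > 0" and "n \<ge> 1"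
  shows "(\<Sum>k=0..2*n-1. (-1) ^ k * theta3 (z + of_nat k * of_real pi / (2 * of_nat n)) \<tau> ^ (2 * n))
      = 2 * of_nat n * (\<Sum>\<^sub>\<infinity>s\<in>tuples_in_class n. tuple_term \<tau> z (2 * n) s)"
proof -
  define d :: "nat \<Rightarrow> complex" where "d k = of_nat k * of_real pi / (2 * of_nat n)" for k
  let ?T = "{1..2*n} \<rightarrow>\<^sub>E (UNIV :: int set)"
  have "(\<Sum>k=0..2*n-1. (-1) ^ k * theta3 (z + d k) \<tau> ^ (2 * n)) =
      (\<Sum>k=0..2*n-1. \<Sum>\<^sub>\<infinity>s\<in>?T. (-1) ^ k * tuple_term \<tau> (z + d k) (2 * n) s)"
    by (simp add: theta3_power_eq_infsum [OF assms(1)] infsum_cmult_right')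
  also have "\<dots> = (\<Sum>\<^sub>\<infinity>s\<in>?T. \<Sum>k=0..2*n-1. (-1) ^ k * tuple_term \<tau> (z + d k) (2 * n) s)"
    by (rule infsum_finite_sum_swap [OF finite_atLeastAtMost])
      (rule summable_on_cmult_right [OF tuple_term_summable [OF assms(1)]])
  also have "\<dots> = (\<Sum>\<^sub>\<infinity>s\<in>?T. tuple_term \<tau> z (2 * n) s *
      (if 2 * int n dvd (\<Sum>i=1..2*n. s i) - int n then 2 * of_nat n else 0))"
    unfolding alternating_root_of_unity_sum [OF assms(2), symmetric] sum_distrib_left
    by (simp add: tuple_term_translate d_def mult_ac)
  also have "\<dots> = (\<Sum>\<^sub>\<infinity>s\<in>tuples_in_class n. 2 * of_nat n * tuple_term \<tau> z (2 * n) s)"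
    by (rule infsum_cong_neutral) (auto simp: tuples_in_class_def)
  finally show ?thesis
    by (simp add: d_def infsum_cmult_right')
qed

section \<open>Reduction to tuples of fixed sum\<close>

definition shift_tuple :: "nat \<Rightarrow> int \<Rightarrow> (nat \<Rightarrow> int) \<Rightarrow> nat \<Rightarrow> int" where
  "shift_tuple m r s = (\<lambda>i\<in>{1..m}. s i + r)"

lemma sum_shift_tuple:
  "(\<Sum>i=1..m. shift_tuple m r s i) = (\<Sum>i=1..m. s i) + int m * r"
  by (simp add: shift_tuple_def sum.distrib)

lemma sum_squares_shift_tuple:
  "(\<Sum>i=1..m. (shift_tuple m r s i)\<^sup>2) =
     (\<Sum>i=1..m. (s i)\<^sup>2) + 2 * r * (\<Sum>i=1..m. s i) + int m * r\<^sup>2"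
  by (simp add: shift_tuple_def power2_sum sum.distrib sum_distrib_left mult_ac)

lemma shift_tuple_inverse:
  assumes "s \<in> {1..m} \<rightarrow>\<^sub>E UNIV"
  shows "shift_tuple m (- r) (shift_tuple m r s) = s"
  using assms by (auto simp: shift_tuple_def fun_eq_iff PiE_def extensional_def)

lemma bij_betw_shift_tuple:
  assumes "n \<ge> 1"
  shows "bij_betw (\<lambda>(r, s). shift_tuple (2 * n) r s)
           (UNIV \<times> int_tuples_with_sum (2 * n) (int n)) (tuples_in_class n)"
proof (rule bij_betw_byWitness)
  define class_index where
    "class_index s = ((\<Sum>i=1..2*n. s i) - int n) div (2 * int n)" for s :: "nat \<Rightarrow> int"
  let ?g = "\<lambda>s. (class_index s, shift_tuple (2 * n) (- class_index s) s)"
  have ext: "shift_tuple m r s \<in> {1..m} \<rightarrow>\<^sub>E UNIV" for m r s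
    by (simp add: shift_tuple_def)
  show "\<forall>a\<in>UNIV \<times> int_tuples_with_sum (2 * n) (int n).
      ?g ((\<lambda>(r, s). shift_tuple (2 * n) r s) a) = a"
  proof (intro ballI, elim SigmaE, hypsubst)
    fix r s
    assume s: "s \<in> int_tuples_with_sum (2 * n) (int n)"
    have "class_index (shift_tuple (2 * n) r s) = r"
      unfolding class_index_def sum_shift_tuple
      using s assms by (simp add: int_tuples_with_sum_def)
    then show "?g ((\<lambda>(r, s). shift_tuple (2 * n) r s) (r, s)) = (r, s)"
      using s shift_tuple_inverse [of s "2 * n" r] by (simp add: int_tuples_with_sum_def)
  qed
  show "\<forall>s\<in>tuples_in_class n. (\<lambda>(r, s). shift_tuple (2 * n) r s) (?g s) = s"
  proof
    fix s
    assume "s \<in> tuples_in_class n"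
    then show "(\<lambda>(r, s). shift_tuple (2 * n) r s) (?g s) = s"
      using shift_tuple_inverse [of s "2 * n" "- class_index s"]
      by (simp add: tuples_in_class_def)
  qed
  show "(\<lambda>(r, s). shift_tuple (2 * n) r s) ` (UNIV \<times> int_tuples_with_sum (2 * n) (int n))
      \<subseteq> tuples_in_class n"
  proof (intro image_subsetI, elim SigmaE, hypsubst)
    fix r s
    assume "s \<in> int_tuples_with_sum (2 * n) (int n)"
    then show "(\<lambda>(r, s). shift_tuple (2 * n) r s) (r, s) \<in> tuples_in_class n"
      unfolding tuples_in_class_def mem_Collect_eq prod.case sum_shift_tuple
      by (simp add: int_tuples_with_sum_def ext del: One_nat_def)
  qed
  show "?g ` tuples_in_class n \<subseteq> UNIV \<times> int_tuples_with_sum (2 * n) (int n)"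
  proof (intro image_subsetI SigmaI UNIV_I)
    fix s
    assume "s \<in> tuples_in_class n"
    then have "2 * int n * class_index s = (\<Sum>i=1..2*n. s i) - int n"
      by (simp add: tuples_in_class_def class_index_def)
    then show "shift_tuple (2 * n) (- class_index s) s \<in> int_tuples_with_sum (2 * n) (int n)"
      unfolding int_tuples_with_sum_def mem_Collect_eq sum_shift_tuple
      by (simp add: ext del: One_nat_def)
  qed
qed

text \<open>
  For \<open>S = n\<close>, translating all \<open>2n\<close> entries by \<open>r\<close> increases half the sum of squares by
  \<open>r n + n r\<^sup>2 = 2n (r (r + 1) / 2)\<close>, which is the exponent of \<open>theta2\<close> at \<open>2n\<tau>\<close>.
\<close>
lemma tuple_term_shift:
  assumes "s \<in> int_tuples_with_sum (2 * n) (int n)"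
  shows "tuple_term \<tau> z (2 * n) (shift_tuple (2 * n) r s) =
      (qpow (2 * of_nat n * \<tau>) (of_int (r * (r + 1)) / 2) *
        exp (of_int (2 * r + 1) * \<i> * (2 * of_nat n * z))) *
      qpow \<tau> (of_int (\<Sum>i=1..2*n. (s i) ^ 2) / 2)"
proof -
  have S: "(\<Sum>i=1..2*n. s i) = int n"
    using assms by (simp add: int_tuples_with_sum_def)
  have "of_int (\<Sum>i=1..2*n. (shift_tuple (2 * n) r s i)\<^sup>2) / 2 =
      of_int (\<Sum>i=1..2*n. (s i)\<^sup>2) / 2 + real (2 * n) * (of_int (r * (r + 1)) / 2)"
    unfolding sum_squares_shift_tuple S by (simp add: field_simps power2_eq_square)
  moreover have "2 * of_int (\<Sum>i=1..2*n. shift_tuple (2 * n) r s i) * \<i> * z =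
      of_int (2 * r + 1) * \<i> * (2 * of_nat n * z)"
    unfolding sum_shift_tuple S by (simp add: algebra_simps)
  moreover have "qpow (2 * of_nat n * \<tau>) a = qpow \<tau> (real (2 * n) * a)" for a
    using qpow_scale [of "2 * n" \<tau> a] by simp
  ultimately show ?thesis
    unfolding tuple_term_def by (simp only: qpow_add mult_ac)
qed

theorem corollary1p8:
  fixes \<tau> z :: complex and n :: nat
  assumes "Im \<tau> > 0" and "n \<ge> 1"
  shows "(\<Sum>k=0..2*n-1. (-1) ^ k * theta3 (z + of_nat k * of_real pi / (2 * of_nat n)) \<tau> ^ (2 * n))
           = H1 n \<tau> * theta2 (2 * of_nat n * z) (2 * of_nat n * \<tau>)"
proof -
  let ?I = "int_tuples_with_sum (2 * n) (int n)"
  define A where "A r = qpow (2 * of_nat n * \<tau>) (of_int (r * (r + 1)) / 2) *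
      exp (of_int (2 * r + 1) * \<i> * (2 * of_nat n * z))" for r :: int
  define B where "B s = qpow \<tau> (of_int (\<Sum>i=1..2*n. (s i) ^ 2) / 2)" for s :: "nat \<Rightarrow> int"
  note bij = bij_betw_shift_tuple [OF assms(2)]
  have factor: "tuple_term \<tau> z (2 * n) ((\<lambda>(r, s). shift_tuple (2 * n) r s) p) =
      (\<lambda>(r, s). A r * B s) p" if "p \<in> UNIV \<times> ?I" for p
    using that tuple_term_shift by (auto simp: A_def B_def)
  have "tuple_term \<tau> z (2 * n) summable_on tuples_in_class n"
    by (rule summable_on_subset_banach [OF tuple_term_summable [OF assms(1)]])
      (auto simp: tuples_in_class_def)
  then have summable: "(\<lambda>(r, s). A r * B s) summable_on UNIV \<times> ?I"
    unfolding summable_on_reindex_bij_betw [OF bij, symmetric]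
    by (simp only: summable_on_cong [OF factor])
  have "(\<Sum>\<^sub>\<infinity>s\<in>tuples_in_class n. tuple_term \<tau> z (2 * n) s) =
      (\<Sum>\<^sub>\<infinity>(r, s)\<in>UNIV \<times> ?I. A r * B s)"
    unfolding infsum_reindex_bij_betw [OF bij, symmetric] by (rule infsum_cong) (rule factor)
  also have "\<dots> = (\<Sum>\<^sub>\<infinity>r. \<Sum>\<^sub>\<infinity>s\<in>?I. A r * B s)"
    using infsum_Sigma'_banach [OF summable] by simp
  also have "\<dots> = infsum A UNIV * infsum B ?I"
    by (simp add: infsum_cmult_left' infsum_cmult_right')
  finally have sum: "(\<Sum>\<^sub>\<infinity>s\<in>tuples_in_class n. tuple_term \<tau> z (2 * n) s) =
      infsum A UNIV * infsum B ?I" .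
  \<comment> \<open>The prefactor of \<open>theta2\<close> at \<open>2n\<tau>\<close> is \<open>q\<close> to the power \<open>2n / 8\<close>.\<close>
  have "qpow \<tau> (- of_nat n / 4) * qpow (2 * of_nat n * \<tau>) (1 / 8) = 1"
    using qpow_scale [of "2 * n" \<tau> "1 / 8"] by (simp add: qpow_def flip: exp_add)
  then have "H1 n \<tau> * theta2 (2 * of_nat n * z) (2 * of_nat n * \<tau>) =
      2 * of_nat n * (infsum A UNIV * infsum B ?I)"
    unfolding H1_def theta2_def A_def [symmetric] B_def [symmetric] by algebra
  then show ?thesis
    unfolding alternating_theta3_sum [OF assms] sum by simp
qed

end
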